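(* For all $d\in\mathbb{N}$, any (nonempty) finite set $\mathcal{M}\subset\mathbb{R}^d$ is super-Ramsey in the case of the Manhattan norm. In particular, there exists $\varepsilon=\varepsilon(\mathcal{M})>0$ such that $$\chi(\mathbb{R}_1^n,\mathcal{M}) \ge (1+\varepsilon+o(1))^n \quad\text{as } n\to\infty.$$
   Context: $\mathbb{R}_1^n$ denotes $\mathbb{R}^n$ equipped with the Manhattan norm $\|\mathbf{x}\|_1=\sum_{i=1}^n|x_i|$. For $\mathcal{M}\subset\mathbb{R}^d$, a subset $\mathcal{M}'\subset\mathbb{R}^n$ is an $\ell_1$-isometric copy of $\mathcal{M}$ if there is a bijection $f:\mathcal{M}\to\mathcal{M}'$ with $\|\mathbf{x}-\mathbf{y}\|_1=\|f(\mathbf{x})-f(\mathbf{y})\|_1$ for all $\mathbf{x},\mathbf{y}\in\mathcal{M}$. The chromatic number $\chi(\mathbb{R}_1^n,\mathcal{M})$ is the smallest $r$ such that there is a coloring of $\mathbb{R}^n$ with $r$ colors and with no monochromatic $\ell_1$-isometric copy of $\mathcal{M}$ (it is $+\infty$ if there is no such coloring). For a finite $V\subset\mathbb{R}^n$, $\alpha(V,\mathcal{M})$ is the maximum cardinality of a subset $W\subset V$ containing no $\ell_1$-isometric copy of $\mathcal{M}$. The set $\mathcal{M}$ is super-Ramsey (in the Manhattan norm) if there exist $\varepsilon>0$ and $C>0$ such that for every dimension $n$ there is a nonempty finite set $V=V(n)\subset\mathbb{R}^n$ with $|V|\le C^n$ and $|V|/\alpha(V,\mathcal{M})\ge(1+\varepsilon+o(1))^n$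 as $n\to\infty$ (the ratio is understood as $+\infty$ when $\alpha(V,\mathcal{M})=0$). *)

theory Defs
  imports Complex_Main "HOL-Library.FuncSet" "HOL-Library.Extended_Real"
begin

text \<open>Since the dimension is quantified over, points of \<open>\<real>\<^sup>n\<close> are represented as
  extensional functions on \<open>{..<n}\<close>.\<close>

abbreviation real_space :: "nat \<Rightarrow> (nat \<Rightarrow> real) set" where
  "real_space n \<equiv> {..<n} \<rightarrow>\<^sub>E UNIV"

definition l1_norm :: "nat \<Rightarrow> (nat \<Rightarrow> real) \<Rightarrow> real" where
  "l1_norm n x = (\<Sum>i<n. \<bar>x i\<bar>)"

definition l1_dist :: "nat \<Rightarrow> (nat \<Rightarrow> real) \<Rightarrow> (nat \<Rightarrow> real) \<Rightarrow> real" where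
  "l1_dist n x y = l1_norm n (\<lambda>i. x i - y i)"

definition l1_isometric_copy ::
  "nat \<Rightarrow> (nat \<Rightarrow> real) set \<Rightarrow> nat \<Rightarrow> (nat \<Rightarrow> real) set \<Rightarrow> bool" where
  "l1_isometric_copy d M n M' \<longleftrightarrow>
     M \<subseteq> real_space d \<and> M' \<subseteq> real_space n \<and>
     (\<exists>f. bij_betw f M M' \<and> (\<forall>x\<in>M. \<forall>y\<in>M. l1_dist d x y = l1_dist n (f x) (f y)))"

definition copy_free_coloring ::
  "nat \<Rightarrow> (nat \<Rightarrow> real) set \<Rightarrow> nat \<Rightarrow> nat \<Rightarrow> ((nat \<Rightarrow> real) \<Rightarrow> nat) \<Rightarrow> bool" where
  "copy_free_coloring d M n r c \<longleftrightarrow>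
     c \<in> real_space n \<rightarrow> {..<r} \<and>
     \<not> (\<exists>M' k. l1_isometric_copy d M n M' \<and> (\<forall>x\<in>M'. c x = k))"

text \<open>The infimum over \<^typ>\<open>enat\<close> is attained when the set is nonempty, and it is
  \<open>\<infinity>\<close> when the set is empty.\<close>

definition l1_chromatic_number :: "nat \<Rightarrow> nat \<Rightarrow> (nat \<Rightarrow> real) set \<Rightarrow> enat" where
  "l1_chromatic_number n d M = Inf {enat r |r. \<exists>c. copy_free_coloring d M n r c}"

text \<open>Only meaningful for finite \<open>V\<close> and nonempty \<open>M\<close>: then the maximum is over a finite
  set that contains \<open>0\<close>, because the empty set contains no copy of \<open>M\<close>.\<close>

definition l1_alpha ::
  "nat \<Rightarrow> (nat \<Rightarrow> real) set \<Rightarrow> nat \<Rightarrow> (nat \<Rightarrow> real) set \<Rightarrow> nat" where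
  "l1_alpha n V d M =
     Max {card W |W. W \<subseteq> V \<and> \<not> (\<exists>M'\<subseteq>W. l1_isometric_copy d M n M')}"

text \<open>\<open>g n \<ge> (1 + \<epsilon> + o(1))\<^sup>n\<close> as \<open>n \<rightarrow> \<infinity>\<close>. The inequality is required only for large
  \<open>n\<close>, where the base is positive.\<close>

definition eventually_ge_power :: "real \<Rightarrow> (nat \<Rightarrow> ereal) \<Rightarrow> bool" where
  "eventually_ge_power \<epsilon> g \<longleftrightarrow>
     (\<exists>\<delta> :: nat \<Rightarrow> real. \<delta> \<longlonglongrightarrow> 0 \<and>
        (\<forall>\<^sub>F n in sequentially. ereal ((1 + \<epsilon> + \<delta> n) ^ n) \<le> g n))"

text \<open>In \<^typ>\<open>ereal\<close>, a positive number divided by \<open>0\<close> is \<open>\<infinity>\<close>.\<close>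

definition super_Ramsey :: "nat \<Rightarrow> (nat \<Rightarrow> real) set \<Rightarrow> bool" where
  "super_Ramsey d M \<longleftrightarrow>
     (\<exists>\<epsilon>>0. \<exists>C>0. \<exists>V :: nat \<Rightarrow> (nat \<Rightarrow> real) set.
        (\<forall>n. V n \<subseteq> real_space n \<and> finite (V n) \<and> V n \<noteq> {} \<and>
             real (card (V n)) \<le> C ^ n) \<and>
        eventually_ge_power \<epsilon>
          (\<lambda>n. ereal (real (card (V n))) / ereal (real (l1_alpha n (V n) d M))))"

end

theory Submission imports Defs begin

text \<open>
  The Manhattan norm is additive over blocks of coordinates, and everything reduces to this.
  Listing, for each coordinate, which of the finitely many occurring values lie below a point
  embeds a finite subset of \<open>\<real>\<^sup>d\<close> isometrically into a weighted cube \<open>{0, w\<^sub>1} \<times> \<dots> \<times> {0, w\<^sub>k}\<close>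
  (\<open>exp_dense_finite_l1_set\<close>). It therefore suffices to have an exponential density theorem for
  two points at a given distance, and to show that such density theorems survive products.

  For two points at distance \<open>l\<close>, the host is the set of scaled indicator vectors of the
  \<open>(2q - 1)\<close>-subsets of a \<open>(4q - 1)\<close>-set, where \<open>q\<close> is a power of two. Two such vectors are at
  distance \<open>l\<close> exactly when the sets meet in \<open>q - 1\<close> points, if the scale is \<open>l / (2 q)\<close>. By the
  argument of Frankl and Wilson over the field with two elements, a family that avoids this
  intersection size has at most \<open>4q - 1 choose q - 1\<close> members, which is exponentially smaller
  than \<open>4q - 1 choose 2q - 1\<close> (\<open>dense_host_two_points\<close>). Every large dimension is
  within a factor of about two of a size \<open>4q - 1\<close>, so padding with zeros costs only a constant
  factor in the exponent.

  For a product, a dense subset \<open>W\<close> of \<open>V \<times> V'\<close> has many dense fibres over \<open>V'\<close>, each of which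
  contains a copy of the first pattern. There are at most \<open>|V|\<^sup>m\<close> such copies, where \<open>m\<close> is the
  size of the first pattern, hence some copy occurs over at least a fraction \<open>1 / |V|\<^sup>m\<close> of
  these fibres. If \<open>V\<close> uses only a small proportion of the coordinates, this loss is less
  than the exponential density gain of \<open>V'\<close>, and the second pattern is found among these points
  (\<open>dense_host_product\<close>, \<open>exp_dense_product\<close>).

  The bound on the chromatic number follows since each colour class meets the host in a
  copy-free set.
\<close>

section \<open>Parity and families of sets\<close>

text \<open>Absorption gives \<open>j * (2\<^sup>k choose j) = 2\<^sup>k * (2\<^sup>k - 1 choose j - 1)\<close>, and \<open>2\<^sup>k\<close> cannot divide \<open>j\<close>.\<close>

lemma even_choose_power_of_two:
  fixes j k :: nat
  assumes "0 < j" "j < 2 ^ k"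
  shows "even ((2 ^ k) choose j)"
proof (rule ccontr)
  assume odd: "odd ((2 ^ k) choose j)"
  have "j * ((2 ^ k) choose j) = 2 ^ k * ((2 ^ k - 1) choose (j - 1))"
    using times_binomial_minus1_eq[of j "2 ^ k"] assms by simp
  then have "2 ^ k dvd j * ((2 ^ k) choose j)"
    by simp
  moreover have "coprime (2 ^ k) ((2 ^ k) choose j)"
    using odd by simp
  ultimately have "2 ^ k dvd j"
    using coprime_dvd_mult_left_iff by blast
  then show False
    using assms by (auto dest: dvd_imp_le)
qed

text \<open>In the Vandermonde expansion modulo 2 only the term with \<open>2\<^sup>k choose 0\<close> survives.\<close>

lemma odd_choose_add_power_of_two:
  fixes x k :: nat
  shows "odd ((2 ^ k + x) choose (2 ^ k - 1)) \<longleftrightarrow> odd (x choose (2 ^ k - 1))"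
proof -
  let ?q = "2 ^ k :: nat"
  let ?f = "\<lambda>j. (?q choose j) * (x choose (?q - 1 - j))"
  have "(?q + x) choose (?q - 1) = (\<Sum>j\<le>?q - 1. ?f j)"
    by (rule vandermonde[symmetric])
  also have "\<dots> = ?f 0 + (\<Sum>j\<in>{..?q - 1} - {0}. ?f j)"
    by (rule sum.remove) auto
  finally have eq: "(?q + x) choose (?q - 1) = ?f 0 + (\<Sum>j\<in>{..?q - 1} - {0}. ?f j)" .
  have "even (\<Sum>j\<in>{..?q - 1} - {0}. ?f j)"
  proof (rule dvd_sum)
    fix j assume "j \<in> {..?q - 1} - {0}"
    then have "0 < j" "j \<le> ?q - 1" by auto
    moreover have "0 < ?q" by simp
    ultimately have "0 < j" "j < ?q" by linarith+
    then show "even (?f j)"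
      using even_choose_power_of_two by simp
  qed
  then show ?thesis
    unfolding eq by simp
qed

text \<open>The parity of \<open>x choose (2\<^sup>k - 1)\<close> detects the residue class \<open>-1\<close> modulo \<open>2\<^sup>k\<close>. This turns a
  condition on intersection sizes into one on a matrix over the field with two elements.\<close>

lemma odd_choose_pred_power_of_two_iff:
  fixes x k :: nat
  assumes "x < 2 * 2 ^ k"
  shows "odd (x choose (2 ^ k - 1)) \<longleftrightarrow> x = 2 ^ k - 1 \<or> x = 2 * 2 ^ k - 1"
proof -
  let ?q = "2 ^ k :: nat"
  have q: "0 < ?q" by simp
  have small: "odd (y choose (?q - 1)) \<longleftrightarrow> y = ?q - 1" if "y < ?q" for y
    using that by (cases "y = ?q - 1") (auto simp: binomial_eq_0)
  show ?thesis
  proof (cases "x < ?q")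
    case True
    then show ?thesis using small q by auto
  next
    case False
    then obtain y where x: "x = ?q + y" using le_Suc_ex not_less by blast
    have "odd (x choose (?q - 1)) \<longleftrightarrow> y = ?q - 1"
      unfolding x using odd_choose_add_power_of_two[of k y] small[of y] assms x by simp
    then show ?thesis using x q by auto
  qed
qed

text \<open>The Frankl--Wilson rank argument modulo 2. The incidence vectors of the members of \<open>F\<close> against
  the \<open>t\<close>-subsets of \<open>X\<close> have inner products \<open>card (A \<inter> B) choose t\<close>, so modulo 2 they are
  orthonormal and hence linearly independent. Independence is used in the form that the subset sums
  \<open>\<Phi> S\<close> of these vectors are pairwise distinct: the inner product of \<open>\<Phi> S\<close> with the vector of \<open>A\<close>
  tells whether \<open>A \<in> S\<close>. Comparing the number of subset sums with the number of all vectors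
  gives the bound.\<close>

lemma card_le_choose_if_odd_choose_Int:
  fixes X :: "'a set"
  assumes fin: "finite X" and FX: "F \<subseteq> Pow X"
    and diag: "\<And>A B. A \<in> F \<Longrightarrow> B \<in> F \<Longrightarrow> odd (card (A \<inter> B) choose t) \<longleftrightarrow> A = B"
  shows "card F \<le> card X choose t"
proof -
  define \<T> where "\<T> = {T. T \<subseteq> X \<and> card T = t}"
  define \<Phi> where "\<Phi> S = {T \<in> \<T>. odd (card {B \<in> S. T \<subseteq> B})}" for S
  have fT: "finite \<T>" unfolding \<T>_def using fin by simp
  have cT: "card \<T> = card X choose t" unfolding \<T>_def using fin n_subsets by blast
  have fF: "finite F" using FX fin by (meson finite_Pow_iff finite_subset)
  have decode: "A \<in> S \<longleftrightarrow> odd (card {T \<in> \<Phi> S. T \<subseteq> A})"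
    if S: "S \<subseteq> F" and A: "A \<in> F" for S A
  proof -
    have fS: "finite S" using S fF finite_subset by blast
    have finA: "finite A" using A FX fin by (meson PowD finite_subset subsetD)
    have ch: "card (A \<inter> B) choose t = card {T \<in> \<T>. T \<subseteq> A \<and> T \<subseteq> B}" if "B \<in> S" for B
    proof -
      have "{T \<in> \<T>. T \<subseteq> A \<and> T \<subseteq> B} = {T. T \<subseteq> A \<inter> B \<and> card T = t}"
        unfolding \<T>_def using A FX by blast
      then show ?thesis using finA n_subsets[of "A \<inter> B" t] by simp
    qed
    have "(\<Sum>B\<in>S. card (A \<inter> B) choose t) = (\<Sum>B\<in>S. card {T \<in> {T\<in>\<T>. T \<subseteq> A}. T \<subseteq> B})"
      by (rule sum.cong) (auto simp: ch intro!: arg_cong[where f = card])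
    also have "\<dots> = (\<Sum>T\<in>{T\<in>\<T>. T \<subseteq> A}. card {B \<in> S. T \<subseteq> B})"
      by (rule sum_multicount_gen) (use fS fT in auto)
    finally have eq: "(\<Sum>B\<in>S. card (A \<inter> B) choose t)
      = (\<Sum>T\<in>{T\<in>\<T>. T \<subseteq> A}. card {B \<in> S. T \<subseteq> B})" .
    have "{B \<in> S. odd (card (A \<inter> B) choose t)} = (if A \<in> S then {A} else {})"
      using diag[OF A] S by auto
    then have "odd (\<Sum>B\<in>S. card (A \<inter> B) choose t) \<longleftrightarrow> A \<in> S"
      using even_sum_iff[OF fS, of "\<lambda>B. card (A \<inter> B) choose t"] by simp
    moreover have "{T \<in> {T\<in>\<T>. T \<subseteq> A}. odd (card {B \<in> S. T \<subseteq> B})} = {T \<in> \<Phi> S. T \<subseteq> A}"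
      unfolding \<Phi>_def by auto
    then have "odd (\<Sum>T\<in>{T\<in>\<T>. T \<subseteq> A}. card {B \<in> S. T \<subseteq> B}) \<longleftrightarrow> odd (card {T \<in> \<Phi> S. T \<subseteq> A})"
      using even_sum_iff[of "{T\<in>\<T>. T \<subseteq> A}" "\<lambda>T. card {B \<in> S. T \<subseteq> B}"] fT by simp
    ultimately show ?thesis using eq by simp
  qed
  have "inj_on \<Phi> (Pow F)"
  proof (rule inj_onI)
    fix S S' assume *: "S \<in> Pow F" "S' \<in> Pow F" "\<Phi> S = \<Phi> S'"
    have "A \<in> S \<longleftrightarrow> A \<in> S'" if "A \<in> F" for A
      using decode[of S A] decode[of S' A] * that by simp
    then show "S = S'" using * by blast
  qed
  moreover have "\<Phi> ` Pow F \<subseteq> Pow \<T>" unfolding \<Phi>_def by blast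
  ultimately have "card (Pow F) \<le> card (Pow \<T>)"
    using fT by (meson card_inj_on_le finite_Pow_iff)
  then show ?thesis using fF fT cT by (simp add: card_Pow)
qed

text \<open>As long as the lower index stays below \<open>5 s\<close>, at most a third of \<open>16 s - 1\<close>, each step in the row
  of Pascal's triangle at least doubles the binomial coefficient. There are \<open>s\<close> such steps from
  \<open>4 s - 1\<close>, and the remaining ones up to the middle do not decrease it.\<close>

lemma two_power_choose_le_central:
  fixes s :: nat
  shows "2 ^ s * ((16 * s - 1) choose (4 * s - 1)) \<le> (16 * s - 1) choose (8 * s - 1)"
proof (cases "s = 0")
  case True
  then show ?thesis by simp
next
  case False
  let ?N = "16 * s - 1"
  have step: "2 * (?N choose k) \<le> ?N choose Suc k" if "Suc k < 5 * s" for k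
  proof -
    have "Suc k * (?N choose Suc k) = (?N - k) * (?N choose k)"
      by (metis binomial_absorb_comp binomial_absorption)
    moreover have "2 * Suc k * (?N choose k) \<le> (?N - k) * (?N choose k)"
      using that by (intro mult_right_mono) auto
    ultimately have "Suc k * (2 * (?N choose k)) \<le> Suc k * (?N choose Suc k)"
      by (simp only: mult.assoc mult.left_commute)
    then show ?thesis by (metis Suc_mult_le_cancel1)
  qed
  have "2 ^ j * (?N choose (4 * s - 1)) \<le> ?N choose (4 * s - 1 + j)" if "j \<le> s" for j
    using that
  proof (induction j)
    case 0
    then show ?case by simp
  next
    case (Suc j)
    then have "2 ^ Suc j * (?N choose (4 * s - 1)) \<le> 2 * (?N choose (4 * s - 1 + j))"
      by simp
    also have "\<dots> \<le> ?N choose Suc (4 * s - 1 + j)"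
      using Suc.prems False by (intro step) linarith
    finally show ?case by simp
  qed
  from this[of s] have "2 ^ s * (?N choose (4 * s - 1)) \<le> ?N choose (4 * s - 1 + s)"
    by simp
  also have "\<dots> \<le> ?N choose (8 * s - 1)"
    using False by (intro binomial_mono) auto
  finally show ?thesis .
qed

section \<open>Distances in \<open>\<ell>\<^sub>1\<close>\<close>

definition append_point :: "nat \<Rightarrow> nat \<Rightarrow> (nat \<Rightarrow> real) \<Rightarrow> (nat \<Rightarrow> real) \<Rightarrow> nat \<Rightarrow> real" where
  "append_point m n x y = restrict (\<lambda>i. if i < m then x i else y (i - m)) {..<m + n}"

lemma append_point_in_real_space: "append_point m n x y \<in> real_space (m + n)"
  unfolding append_point_def by simp

lemma inj_on_append_point:
  "inj_on (\<lambda>(x, y). append_point m n x y) (real_space m \<times> real_space n)"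
proof (rule inj_onI, clarify)
  fix x y x' y'
  assume x: "x \<in> real_space m" "x' \<in> real_space m" and y: "y \<in> real_space n" "y' \<in> real_space n"
    and eq: "append_point m n x y = append_point m n x' y'"
  have xx: "x i = x' i" if "i < m" for i
    using fun_cong[OF eq, of i] that by (simp add: append_point_def)
  have yy: "y i = y' i" if "i < n" for i
    using fun_cong[OF eq, of "m + i"] that by (simp add: append_point_def)
  show "x = x' \<and> y = y'"
    using PiE_ext[OF x] PiE_ext[OF y] xx yy by simp
qed

lemma l1_dist_append_point:
  "l1_dist (m + n) (append_point m n x y) (append_point m n x' y')
     = l1_dist m x x' + l1_dist n y y'"
proof -
  have "(\<Sum>i<m + k. \<bar>append_point m n x y i - append_point m n x' y' i\<bar>)
      = (\<Sum>i<m. \<bar>x i - x' i\<bar>) + (\<Sum>i<k. \<bar>y i - y' i\<bar>)" if "k \<le> n" for k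
    using that
  proof (induction k)
    case 0
    then show ?case by (auto simp: append_point_def intro!: sum.cong)
  next
    case (Suc k)
    then show ?case by (simp add: append_point_def)
  qed
  then show ?thesis unfolding l1_dist_def l1_norm_def by simp
qed

lemma l1_dist_self: "l1_dist n x x = 0"
  unfolding l1_dist_def l1_norm_def by simp

lemma l1_dist_commute: "l1_dist n x y = l1_dist n y x"
  unfolding l1_dist_def l1_norm_def by (simp add: abs_minus_commute)

lemma l1_dist_eq_0D:
  assumes "x \<in> real_space n" "y \<in> real_space n" "l1_dist n x y = 0"
  shows "x = y"
proof -
  have "\<forall>i\<in>{..<n}. \<bar>x i - y i\<bar> = 0"
    using assms(3) unfolding l1_dist_def l1_norm_def
    by (subst (asm) sum_nonneg_eq_0_iff) auto
  then show ?thesis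
    using PiE_ext[OF assms(1,2)] by simp
qed

definition scaled_indicator :: "nat \<Rightarrow> real \<Rightarrow> nat set \<Rightarrow> nat \<Rightarrow> real" where
  "scaled_indicator n a A = restrict (\<lambda>i. if i \<in> A then a else 0) {..<n}"

lemma scaled_indicator_in_real_space: "scaled_indicator n a A \<in> real_space n"
  unfolding scaled_indicator_def by simp

lemma inj_on_scaled_indicator:
  assumes "a \<noteq> 0"
  shows "inj_on (scaled_indicator n a) (Pow {..<n})"
proof (rule inj_onI)
  fix A B assume *: "A \<in> Pow {..<n}" "B \<in> Pow {..<n}"
    and eq: "scaled_indicator n a A = scaled_indicator n a B"
  have "i \<in> A \<longleftrightarrow> i \<in> B" if "i < n" for i
    using fun_cong[OF eq, of i] that assms by (auto simp: scaled_indicator_def split: if_splits)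
  then show "A = B" using * by blast
qed

lemma l1_dist_scaled_indicator:
  assumes "A \<subseteq> {..<n}" "B \<subseteq> {..<n}" "a \<ge> 0" "card A = card B"
  shows "l1_dist n (scaled_indicator n a A) (scaled_indicator n a B)
    = a * (2 * (real (card A) - real (card (A \<inter> B))))"
proof -
  have fin: "finite A" "finite B" using assms finite_subset by blast+
  have "l1_dist n (scaled_indicator n a A) (scaled_indicator n a B)
      = (\<Sum>i<n. (if i \<in> A - B then a else 0) + (if i \<in> B - A then a else 0))"
    unfolding l1_dist_def l1_norm_def
    by (rule sum.cong) (use assms in \<open>auto simp: scaled_indicator_def\<close>)
  also have "\<dots> = (\<Sum>i\<in>A - B. a) + (\<Sum>i\<in>B - A. a)"
  proof -
    have "{..<n} \<inter> (A - B) = A - B" "{..<n} \<inter> (B - A) = B - A" using assms by auto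
    then show ?thesis
      by (simp add: sum.distrib sum.inter_restrict[symmetric] del: Diff_iff)
  qed
  also have "\<dots> = a * (real (card (A - B)) + real (card (B - A)))"
    by (simp add: algebra_simps)
  also have "real (card (A - B)) = real (card A) - real (card (A \<inter> B))"
    using fin by (simp add: card_Diff_subset_Int of_nat_diff card_mono)
  also have "real (card (B - A)) = real (card B) - real (card (B \<inter> A))"
    using fin by (simp add: card_Diff_subset_Int of_nat_diff card_mono)
  finally show ?thesis using assms(4) by (simp add: Int_commute algebra_simps)
qed

section \<open>Patterns with an exponential density theorem\<close>

text \<open>A pattern is an index set with prescribed distances, rather than a set of points. Patterns
  can then be formed as products and pulled back along maps without choosing coordinates.\<close>

definition realizes :: "nat \<Rightarrow> 'a set \<Rightarrow> ('a \<Rightarrow> 'a \<Rightarrow> real) \<Rightarrow> (nat \<Rightarrow> real) set \<Rightarrow> bool" where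
  "realizes n I D W \<longleftrightarrow>
     (\<exists>f. f ` I \<subseteq> W \<and> (\<forall>i\<in>I. \<forall>j\<in>I. l1_dist n (f i) (f j) = D i j))"

text \<open>The density threshold \<open>1 / s\<close> is stated without a division: \<open>W\<close> has density at least \<open>1 / s\<close>
  in \<open>V\<close>.\<close>

definition dense_host ::
  "nat \<Rightarrow> 'a set \<Rightarrow> ('a \<Rightarrow> 'a \<Rightarrow> real) \<Rightarrow> real \<Rightarrow> (nat \<Rightarrow> real) set \<Rightarrow> bool" where
  "dense_host n I D s V \<longleftrightarrow> V \<subseteq> real_space n \<and> finite V \<and> V \<noteq> {} \<and>
     (\<forall>W\<subseteq>V. real (card V) \<le> s * real (card W) \<longrightarrow> realizes n I D W)"

text \<open>The super-Ramsey property for patterns. Small dimensions have to be excluded because a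
  pattern with two points at nonzero distance has no host in dimension 0.\<close>

definition exp_dense :: "'a set \<Rightarrow> ('a \<Rightarrow> 'a \<Rightarrow> real) \<Rightarrow> bool" where
  "exp_dense I D \<longleftrightarrow>
     (\<exists>c>1. \<exists>C\<ge>1. \<forall>\<^sub>F n in sequentially. \<exists>V. dense_host n I D (c ^ n) V \<and> real (card V) \<le> C ^ n)"

lemma exp_denseI:
  assumes "1 < c" "1 \<le> C"
    and "\<forall>\<^sub>F n in sequentially. \<exists>V. dense_host n I D (c ^ n) V \<and> real (card V) \<le> C ^ n"
  shows "exp_dense I D"
  unfolding exp_dense_def using assms by (intro exI[of _ c] exI[of _ C] conjI)

lemma realizes_embed:
  assumes "realizes n I D W" "g ` J \<subseteq> I" "\<And>i j. i \<in> J \<Longrightarrow> j \<in> J \<Longrightarrow> D (g i) (g j) = D' i j"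
  shows "realizes n J D' W"
proof -
  obtain f where "f ` I \<subseteq> W" "\<forall>i\<in>I. \<forall>j\<in>I. l1_dist n (f i) (f j) = D i j"
    using assms(1) unfolding realizes_def by blast
  moreover have "g i \<in> I" if "i \<in> J" for i using assms(2) that by blast
  ultimately have "(f \<circ> g) ` J \<subseteq> W"
    "\<forall>i\<in>J. \<forall>j\<in>J. l1_dist n ((f \<circ> g) i) ((f \<circ> g) j) = D' i j"
    using assms(3) by fastforce+
  then show ?thesis unfolding realizes_def by blast
qed

lemma exp_dense_embed:
  assumes "exp_dense I D" "g ` J \<subseteq> I" "\<And>i j. i \<in> J \<Longrightarrow> j \<in> J \<Longrightarrow> D (g i) (g j) = D' i j"
  shows "exp_dense J D'"
proof -
  have "realizes n J D' W" if "realizes n I D W" for n W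
    by (rule realizes_embed[OF that, of g]) (use assms(2,3) in auto)
  then have host: "dense_host n J D' s V" if "dense_host n I D s V" for n s V
    using that unfolding dense_host_def by blast
  obtain c C where c: "1 < c" "1 \<le> C"
    and ev: "\<forall>\<^sub>F n in sequentially. \<exists>V. dense_host n I D (c ^ n) V \<and> real (card V) \<le> C ^ n"
    using assms(1) unfolding exp_dense_def by blast
  show ?thesis
  proof (rule exp_denseI[OF c])
    show "\<forall>\<^sub>F n in sequentially. \<exists>V. dense_host n J D' (c ^ n) V \<and> real (card V) \<le> C ^ n"
      using ev by (rule eventually_mono) (use host in blast)
  qed
qed

lemma exp_dense_singleton: "exp_dense {a} (\<lambda>_ _. 0)"
proof -
  have host: "dense_host n {a} (\<lambda>_ _. 0) (2 ^ n) {\<lambda>i\<in>{..<n}. 0}" for n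
  proof -
    have "realizes n {a} (\<lambda>_ _. 0) W" if "W = {\<lambda>i\<in>{..<n}. 0}" for W
      unfolding realizes_def using that
      by (intro exI[of _ "\<lambda>_. \<lambda>i\<in>{..<n}. 0"]) (simp add: l1_dist_self)
    moreover have "W = {\<lambda>i\<in>{..<n}. 0}"
      if "W \<subseteq> {\<lambda>i\<in>{..<n}. 0 :: real}" "1 \<le> 2 ^ n * real (card W)" for W
      using that by (auto simp: subset_singleton_iff)
    ultimately show ?thesis unfolding dense_host_def by (simp del: of_nat_le_iff) blast
  qed
  show ?thesis
  proof (rule exp_denseI[where c = 2 and C = 1])
    show "\<forall>\<^sub>F n in sequentially.
        \<exists>V. dense_host n {a} (\<lambda>_ _. 0) (2 ^ n) V \<and> real (card V) \<le> 1 ^ n"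
    proof (intro always_eventually allI exI conjI)
      fix n show "dense_host n {a} (\<lambda>_ _. 0) (2 ^ n) {\<lambda>i\<in>{..<n}. 0}" by (rule host)
    qed simp
  qed simp_all
qed

section \<open>Two points\<close>

text \<open>The bounds on \<open>n\<close> place \<open>4 q - 1 = 16 s - 1\<close> coordinates inside \<open>{..<n}\<close> with \<open>q = 4 s\<close>, while
  \<open>n < 32 s\<close> keeps the gain \<open>2\<^sup>s\<close> exponential in \<open>n\<close>. Two members of the host that meet in
  \<open>2 q - 1\<close> points are equal, and the only smaller size that is \<open>-1\<close> modulo \<open>q\<close> is \<open>q - 1\<close>.\<close>

lemma dense_host_two_points:
  fixes l :: real
  assumes l: "l > 0" and n: "16 * 2 ^ k \<le> Suc n" "Suc n \<le> 32 * 2 ^ k"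
  shows "\<exists>V. dense_host n UNIV (\<lambda>a b. if a = (b :: bool) then 0 else l) ((51 / 50) ^ n) V
    \<and> real (card V) \<le> 2 ^ n"
proof -
  define s where "s = (2 ^ k :: nat)"
  define q where "q = (2 ^ (k + 2) :: nat)"
  define N where "N = 16 * s - 1"
  have s: "s \<ge> 1" and qs: "q = 4 * s" unfolding s_def q_def by (simp_all add: power_add)
  have N: "N \<le> n" "n < 32 * s" using n unfolding N_def s_def by linarith+
  define a where "a = l / (2 * q)"
  have a: "a > 0" using l s qs unfolding a_def by simp
  define \<A> where "\<A> = {A. A \<subseteq> {..<N} \<and> card A = 8 * s - 1}"
  define V where "V = scaled_indicator n a ` \<A>"
  have \<A>n: "\<A> \<subseteq> Pow {..<n}" using N unfolding \<A>_def by auto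
  have inj: "inj_on (scaled_indicator n a) \<A>"
    using inj_on_scaled_indicator[of a n] a \<A>n inj_on_subset by blast
  have fin: "finite \<A>" using \<A>n finite_subset by blast
  have cV: "card V = N choose (8 * s - 1)"
    unfolding V_def card_image[OF inj] unfolding \<A>_def by (simp add: n_subsets)
  have pos: "card V > 0" unfolding cV N_def by simp
  \<comment> \<open>Any base \<open>c > 1\<close> with \<open>c ^ 32 < 2\<close> serves.\<close>
  have "(51 / 50 :: real) ^ n \<le> (51 / 50) ^ (32 * s)"
    using N by (intro power_increasing) auto
  also have "\<dots> = ((51 / 50) ^ 32) ^ s" by (rule power_mult)
  also have "\<dots> < 2 ^ s" using s by (intro power_strict_mono) (auto simp: field_simps)
  finally have base: "(51 / 50 :: real) ^ n < 2 ^ s" .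
  have realizes: "realizes n UNIV (\<lambda>a b. if a = (b :: bool) then 0 else l) W"
    if WV: "W \<subseteq> V" and dense: "real (card V) \<le> (51 / 50) ^ n * real (card W)" for W
  proof -
    obtain F where F: "F \<subseteq> \<A>" "W = scaled_indicator n a ` F"
      using WV unfolding V_def by (meson subset_imageE)
    have cF: "card W = card F" using F inj by (metis card_image inj_on_subset)
    have "\<exists>A\<in>F. \<exists>B\<in>F. card (A \<inter> B) = q - 1"
    proof (rule ccontr)
      assume none: "\<not> ?thesis"
      have "card F \<le> card {..<N} choose (q - 1)"
      proof (rule card_le_choose_if_odd_choose_Int)
        show "F \<subseteq> Pow {..<N}" using F unfolding \<A>_def by auto
        fix A B assume AB: "A \<in> F" "B \<in> F"
        then have cards: "card A = 8 * s - 1" "card B = 8 * s - 1" and finAB: "finite A" "finite B"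
          using F unfolding \<A>_def by (auto intro: finite_subset)
        have le: "card (A \<inter> B) \<le> 8 * s - 1" using card_mono[of A "A \<inter> B"] finAB cards by auto
        have "card (A \<inter> B) < 2 * q" using le s qs by linarith
        then have "odd (card (A \<inter> B) choose (q - 1)) \<longleftrightarrow> card (A \<inter> B) = 2 * q - 1"
          using odd_choose_pred_power_of_two_iff[of "card (A \<inter> B)" "k + 2"] none AB
          unfolding q_def by auto
        also have "\<dots> \<longleftrightarrow> A = B"
        proof
          assume "card (A \<inter> B) = 2 * q - 1"
          then have "card (A \<inter> B) = card A" "card (A \<inter> B) = card B" using cards qs by auto
          then show "A = B"
            using card_subset_eq[of A "A \<inter> B"] card_subset_eq[of B "A \<inter> B"] finAB by auto
        qed (use cards qs in auto)
        finally show "odd (card (A \<inter> B) choose (q - 1)) \<longleftrightarrow> A = B" .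
      qed simp
      then have "card W \<le> N choose (4 * s - 1)" using cF qs by simp
      moreover have "0 < N choose (4 * s - 1)" unfolding N_def by simp
      ultimately have "(51 / 50) ^ n * real (card W) < 2 ^ s * real (N choose (4 * s - 1))"
        by (intro order.strict_trans1[OF mult_left_mono mult_strict_right_mono[OF base]]) auto
      also have "\<dots> \<le> real (card V)"
        using two_power_choose_le_central[of s] unfolding cV N_def
        by (metis of_nat_le_iff of_nat_mult of_nat_numeral of_nat_power)
      finally show False using dense by simp
    qed
    then obtain A B where AB: "A \<in> F" "B \<in> F" "card (A \<inter> B) = q - 1" by blast
    define f where "f b = scaled_indicator n a (if b then A else B)" for b
    have sub: "A \<subseteq> {..<n}" "B \<subseteq> {..<n}" and cards: "card A = 2 * q - 1" "card B = 2 * q - 1"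
      using AB F \<A>n qs unfolding \<A>_def by auto
    have "l1_dist n (f True) (f False) = a * (2 * (real (2 * q - 1) - real (q - 1)))"
      unfolding f_def using l1_dist_scaled_indicator[OF sub] cards AB(3) a by simp
    also have "\<dots> = l" using qs s unfolding a_def by (simp add: of_nat_diff)
    finally have "l1_dist n (f True) (f False) = l" .
    then have "l1_dist n (f x) (f y) = (if x = y then 0 else l)" for x y
      by (cases x; cases y) (auto simp: l1_dist_self l1_dist_commute)
    moreover have "f ` UNIV \<subseteq> W" using AB F unfolding f_def by auto
    ultimately show ?thesis unfolding realizes_def by blast
  qed
  have "V \<subseteq> real_space n" unfolding V_def using scaled_indicator_in_real_space by blast
  moreover have "finite V" unfolding V_def using fin by simp
  moreover have "V \<noteq> {}" using pos by auto
  moreover have "real (card V) \<le> 2 ^ n"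
  proof -
    have "card V \<le> 2 ^ N" unfolding cV by (rule binomial_le_pow2)
    also have "(2::nat) ^ N \<le> 2 ^ n" using N by (intro power_increasing) auto
    finally show ?thesis by (metis of_nat_le_iff of_nat_numeral of_nat_power)
  qed
  ultimately show ?thesis using realizes unfolding dense_host_def by blast
qed

lemma exp_dense_two_points:
  fixes l :: real
  assumes "l > 0"
  shows "exp_dense UNIV (\<lambda>a b. if a = (b :: bool) then 0 else l)"
proof -
  have "\<exists>V. dense_host n UNIV (\<lambda>a b. if a = (b :: bool) then 0 else l) ((51 / 50) ^ n) V
    \<and> real (card V) \<le> 2 ^ n" if n: "n \<ge> 15" for n
  proof -
    have "1 \<le> Suc n div 16" using n by simp
    then obtain k where "2 ^ k \<le> Suc n div 16" "Suc n div 16 < 2 ^ Suc k"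
      using ex_power_ivl1[of 2 "Suc n div 16"] by auto
    then have "16 * 2 ^ k \<le> Suc n" "Suc n \<le> 32 * 2 ^ k" by auto
    then show ?thesis using dense_host_two_points assms by blast
  qed
  then show ?thesis
    unfolding exp_dense_def
    by (intro exI[of _ "51 / 50"] exI[of _ 2] conjI eventually_sequentiallyI[of 15]) auto
qed

section \<open>Products of patterns\<close>

text \<open>Fibres of density less than \<open>1 / s\<close> contribute at most a proportion \<open>1 / s \<le> 1 / (2 t)\<close> to \<open>P\<close>,
  that is, at most half of its density \<open>1 / t\<close>. The other half lies over \<open>G\<close>.\<close>

lemma many_dense_fibres:
  fixes s t :: real
  assumes "finite X" "X \<noteq> {}" "finite Y" "P \<subseteq> X \<times> Y" "0 < s" "0 \<le> t" "2 * t \<le> s"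
    and dense: "real (card X) * real (card Y) \<le> t * real (card P)"
  defines "G \<equiv> {y \<in> Y. real (card X) \<le> s * real (card {x. (x, y) \<in> P})}"
  shows "real (card Y) \<le> 2 * t * real (card G)"
proof -
  let ?fib = "\<lambda>y. {x. (x, y) \<in> P}"
  have G: "G \<subseteq> Y" "finite G" using assms(3) unfolding G_def by auto
  have fib: "?fib y \<subseteq> X" for y using assms(4) by auto
  have "P = (\<lambda>(y, x). (x, y)) ` (SIGMA y:Y. ?fib y)" using assms(4) by force
  moreover have "inj_on (\<lambda>(y, x). (x, y)) (SIGMA y:Y. ?fib y)" by (auto intro: inj_onI)
  ultimately have "card P = card (SIGMA y:Y. ?fib y)" by (metis card_image)
  also have "\<dots> = (\<Sum>y\<in>Y. card (?fib y))"
    using assms(1,3) fib by (intro card_SigmaI) (auto intro: finite_subset)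
  finally have "real (card P) = (\<Sum>y\<in>G. real (card (?fib y))) + (\<Sum>y\<in>Y - G. real (card (?fib y)))"
    using sum.subset_diff[OF G(1) assms(3), of "\<lambda>y. real (card (?fib y))"] by simp
  also have "(\<Sum>y\<in>G. real (card (?fib y))) \<le> real (card G) * real (card X)"
    using assms(1) fib by (intro sum_bounded_above) (auto intro: card_mono)
  also have "(\<Sum>y\<in>Y - G. real (card (?fib y))) \<le> real (card (Y - G)) * (real (card X) / s)"
    using assms(5) by (intro sum_bounded_above) (auto simp: G_def field_simps)
  also have "\<dots> \<le> real (card Y) * (real (card X) / s)"
    using assms by (intro mult_right_mono) (auto intro: card_mono)
  finally have P: "real (card P) \<le> real (card G) * real (card X) + real (card Y) * (real (card X) / s)"
    by simp
  have "real (card X) * real (card Y) \<le> t * real (card P)" by (rule dense)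
  also have "\<dots> \<le> t * (real (card G) * real (card X) + real (card Y) * (real (card X) / s))"
    using P assms(6) by (intro mult_left_mono)
  also have "\<dots> = real (card X) * (t * real (card G)) + (t / s) * (real (card X) * real (card Y))"
    by (simp add: algebra_simps)
  also have "(t / s) * (real (card X) * real (card Y)) \<le> 1 / 2 * (real (card X) * real (card Y))"
    using assms(5,7) by (intro mult_right_mono) (auto simp: field_simps)
  finally have "real (card X) * real (card Y) \<le> real (card X) * (2 * t * real (card G))"
    by (simp add: algebra_simps)
  moreover have "0 < real (card X)" using assms(1,2) by (simp add: card_gt_0_iff)
  ultimately show ?thesis by simp
qed

lemma popular_value:
  assumes "finite G" "finite F" "F \<noteq> {}" "\<phi> ` G \<subseteq> F"
  shows "\<exists>v\<in>F. card G \<le> card F * card {y \<in> G. \<phi> y = v}"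
proof (rule ccontr)
  assume "\<not> ?thesis"
  then have less: "card F * card {y \<in> G. \<phi> y = v} < card G" if "v \<in> F" for v
    using that by (meson not_le)
  have "card G = (\<Sum>v\<in>F. card {y \<in> G. \<phi> y = v})"
    using sum.group[OF assms(1,2,4), of "\<lambda>_. 1::nat"] by simp
  then have "card F * card G = (\<Sum>v\<in>F. card F * card {y \<in> G. \<phi> y = v})"
    by (simp add: sum_distrib_left)
  also have "\<dots> < (\<Sum>v\<in>F. card G)"
    using less assms by (intro sum_strict_mono) auto
  finally show False by simp
qed

text \<open>The copies of the first pattern in the dense fibres are maps from \<open>I\<close> to \<open>V\<close>, so one of at most
  \<open>|V| ^ |I|\<close> maps \<open>v\<close> is used over a large part of \<open>V'\<close>. A copy \<open>g\<close> of the second pattern in that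
  part gives a copy of the product, because \<open>(v i, g j)\<close> lies in \<open>P\<close> for all \<open>i\<close> and \<open>j\<close>.\<close>

lemma dense_host_product:
  fixes s t u :: real
  assumes V: "dense_host m I D s V" and V': "dense_host n J D' u V'" and I: "finite I"
    and s: "0 < s" and t: "0 \<le> t" "2 * t \<le> s" "2 * t * real (card V) ^ card I \<le> u"
  shows "dense_host (m + n) (I \<times> J) (\<lambda>(i, j) (i', j'). D i i' + D' j j') t
           ((\<lambda>(x, y). append_point m n x y) ` (V \<times> V'))"
    (is "dense_host _ _ ?D _ (?h ` _)")
proof -
  have fin: "finite V" "finite V'" and ne: "V \<noteq> {}" "V' \<noteq> {}"
    and sub: "V \<subseteq> real_space m" "V' \<subseteq> real_space n"
    using V V' unfolding dense_host_def by auto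
  have inj: "inj_on ?h (V \<times> V')"
    using inj_on_append_point by (rule inj_on_subset) (use sub in auto)
  have "realizes (m + n) (I \<times> J) ?D W"
    if W: "W \<subseteq> ?h ` (V \<times> V')" and dense: "real (card (?h ` (V \<times> V'))) \<le> t * real (card W)" for W
  proof -
    obtain P where P: "P \<subseteq> V \<times> V'" "W = ?h ` P" using W by (meson subset_imageE)
    define G where "G = {y \<in> V'. real (card V) \<le> s * real (card {x. (x, y) \<in> P})}"
    have "real (card V) * real (card V') \<le> t * real (card P)"
      using dense P inj by (simp add: card_image card_cartesian_product inj_on_subset)
    then have G: "real (card V') \<le> 2 * t * real (card G)"
      unfolding G_def using many_dense_fibres[OF fin(1) ne(1) fin(2) P(1) s t(1,2)] by blast
    have "realizes m I D {x. (x, y) \<in> P}" if "y \<in> G" for y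
    proof -
      have "{x. (x, y) \<in> P} \<subseteq> V" using P(1) by auto
      then show ?thesis using V that unfolding dense_host_def G_def by auto
    qed
    then have "\<forall>y\<in>G. \<exists>f. f ` I \<subseteq> {x. (x, y) \<in> P} \<and>
        (\<forall>i\<in>I. \<forall>j\<in>I. l1_dist m (f i) (f j) = D i j)"
      unfolding realizes_def by (rule ballI)
    from bchoice[OF this] obtain f where f: "\<forall>y\<in>G. f y ` I \<subseteq> {x. (x, y) \<in> P} \<and>
        (\<forall>i\<in>I. \<forall>j\<in>I. l1_dist m (f y i) (f y j) = D i j)" ..
    have finG: "finite G" unfolding G_def using fin by simp
    have "\<exists>v\<in>I \<rightarrow>\<^sub>E V. card G \<le> card (I \<rightarrow>\<^sub>E V) * card {y \<in> G. restrict (f y) I = v}"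
    proof (rule popular_value)
      show "(\<lambda>y. restrict (f y) I) ` G \<subseteq> I \<rightarrow>\<^sub>E V"
      proof (rule image_subsetI)
        fix y assume "y \<in> G"
        then have "f y ` I \<subseteq> {x. (x, y) \<in> P}" using f by blast
        then have "f y i \<in> V" if "i \<in> I" for i using that P(1) by blast
        then show "restrict (f y) I \<in> I \<rightarrow>\<^sub>E V" by simp
      qed
      show "I \<rightarrow>\<^sub>E V \<noteq> {}" using ne by (simp add: PiE_eq_empty_iff)
    qed (use finG I fin in \<open>auto intro: finite_PiE\<close>)
    then obtain v where v: "card G \<le> card V ^ card I * card {y \<in> G. restrict (f y) I = v}"
      using I by (auto simp: card_PiE)
    let ?Y = "{y \<in> G. restrict (f y) I = v}"
    have "real (card V') \<le> 2 * t * (real (card V) ^ card I * real (card ?Y))"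
    proof -
      have "real (card G) \<le> real (card V) ^ card I * real (card ?Y)"
        using of_nat_mono[OF v, where ?'a = real] by simp
      then show ?thesis by (intro order_trans[OF G] mult_left_mono) (use t(1) in auto)
    qed
    also have "\<dots> \<le> u * real (card ?Y)"
      using mult_right_mono[OF t(3), of "real (card ?Y)"] by (simp add: mult.assoc)
    finally have "realizes n J D' ?Y"
      using V' unfolding dense_host_def G_def by auto
    then obtain g where "g ` J \<subseteq> ?Y \<and> (\<forall>i\<in>J. \<forall>j\<in>J. l1_dist n (g i) (g j) = D' i j)"
      unfolding realizes_def ..
    then have g: "g ` J \<subseteq> ?Y" "\<forall>i\<in>J. \<forall>j\<in>J. l1_dist n (g i) (g j) = D' i j"
      by (rule conjunct1, rule conjunct2)
    have fv: "f y i = v i" if "y \<in> ?Y" "i \<in> I" for y i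
      using that by (auto dest: fun_cong[of _ _ i])
    have "?Y \<noteq> {}"
    proof
      assume "?Y = {}"
      then have "card G = 0" using v by (simp only: card.empty mult_0_right le_0_eq)
      then show False using G ne fin by simp
    qed
    then obtain y0 where y0: "y0 \<in> ?Y" by blast
    have dv: "l1_dist m (v i) (v j) = D i j" if "i \<in> I" "j \<in> I" for i j
      using bspec[OF f, of y0] y0 fv[OF y0] that by auto
    have "(v i, g j) \<in> P" if "i \<in> I" "j \<in> J" for i j
    proof -
      have gj: "g j \<in> ?Y" using g(1) that(2) by blast
      then have "f (g j) ` I \<subseteq> {x. (x, g j) \<in> P}" using f by blast
      then have "(f (g j) i, g j) \<in> P" using that(1) by blast
      then show ?thesis using fv[OF gj that(1)] by simp
    qed
    then have in_W: "append_point m n (v i) (g j) \<in> W" if "i \<in> I" "j \<in> J" for i j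
      unfolding P(2) using that by (intro image_eqI[of _ _ "(v i, g j)"]) simp_all
    show ?thesis
      unfolding realizes_def
    proof (intro exI[of _ "\<lambda>(i, j). append_point m n (v i) (g j)"] conjI ballI)
      show "(\<lambda>(i, j). append_point m n (v i) (g j)) ` (I \<times> J) \<subseteq> W" using in_W by auto
      fix p p' assume "p \<in> I \<times> J" "p' \<in> I \<times> J"
      then show "l1_dist (m + n) (case p of (i, j) \<Rightarrow> append_point m n (v i) (g j))
          (case p' of (i, j) \<Rightarrow> append_point m n (v i) (g j)) = ?D p p'"
        using dv g(2) by (auto simp: l1_dist_append_point)
    qed
  qed
  moreover have "?h ` (V \<times> V') \<subseteq> real_space (m + n)"
    using append_point_in_real_space[of m n] by (intro image_subsetI) (simp add: case_prod_unfold)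
  ultimately show ?thesis
    unfolding dense_host_def using fin ne by blast
qed

text \<open>The first factor gets \<open>k = n div L\<close> of the \<open>n\<close> coordinates. The constant \<open>L\<close> is chosen so large
  that the bound \<open>C\<^sub>1 ^ (k * |I|)\<close> on the number of copies of the first pattern is absorbed by the
  density gain \<open>c\<^sub>2 ^ (n - k)\<close> of the second factor. The base \<open>c\<close> of the product is so close to 1
  that \<open>2 * c ^ n\<close> is at most \<open>c\<^sub>1 ^ k\<close> and \<open>c\<^sub>2 ^ k\<close>.\<close>

lemma exp_dense_product:
  assumes ID: "exp_dense I D" and JD: "exp_dense J D'" and I: "finite I"
  shows "exp_dense (I \<times> J) (\<lambda>(i, j) (i', j'). D i i' + D' j j')" (is "exp_dense _ ?D")
proof -
  obtain c\<^sub>1 C\<^sub>1 N\<^sub>1 where c1: "c\<^sub>1 > 1" "C\<^sub>1 \<ge> 1"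
    and V1: "\<And>n. n \<ge> N\<^sub>1 \<Longrightarrow> \<exists>V. dense_host n I D (c\<^sub>1 ^ n) V \<and> real (card V) \<le> C\<^sub>1 ^ n"
    using ID unfolding exp_dense_def eventually_sequentially by blast
  obtain c\<^sub>2 C\<^sub>2 N\<^sub>2 where c2: "c\<^sub>2 > 1" "C\<^sub>2 \<ge> 1"
    and V2: "\<And>n. n \<ge> N\<^sub>2 \<Longrightarrow> \<exists>V. dense_host n J D' (c\<^sub>2 ^ n) V \<and> real (card V) \<le> C\<^sub>2 ^ n"
    using JD unfolding exp_dense_def eventually_sequentially by blast
  obtain L0 where "c\<^sub>2 * C\<^sub>1 ^ card I < c\<^sub>2 ^ L0" using real_arch_pow[OF c2(1)] by blast
  also have "c\<^sub>2 ^ L0 \<le> c\<^sub>2 ^ Suc L0" using c2 by (intro power_increasing) auto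
  finally obtain L where L: "c\<^sub>2 * C\<^sub>1 ^ card I \<le> c\<^sub>2 ^ (L - 1)" "L \<ge> 2"
    by (intro that[of "L0 + 2"]) auto
  \<comment> \<open>Since \<open>n \<le> 2 * L * k\<close>, the base \<open>c\<close> satisfies \<open>c ^ n \<le> a ^ k\<close>, where \<open>a\<^sup>2 = min c\<^sub>1 c\<^sub>2\<close>. The second
    factor \<open>a ^ k\<close> then pays for the constant 2.\<close>
  define c where "c = root (4 * L) (min c\<^sub>1 c\<^sub>2)"
  define a where "a = c ^ (2 * L)"
  have c: "c > 1" using c1 c2 L(2) unfolding c_def by simp
  have a1: "a > 1" unfolding a_def using c L(2) by (intro one_less_power) auto
  have "a ^ 2 = c ^ (4 * L)" unfolding a_def by (simp flip: power_mult)
  also have "\<dots> = min c\<^sub>1 c\<^sub>2" unfolding c_def using c1 c2 L(2) by (intro real_root_pow_pos2) auto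
  finally have a2: "a ^ 2 \<le> c\<^sub>1" "a ^ 2 \<le> c\<^sub>2" by auto
  obtain K where K: "2 < a ^ K" using real_arch_pow[OF a1] by blast
  define C where "C = max C\<^sub>1 C\<^sub>2"
  have "\<exists>V. dense_host n (I \<times> J) ?D (c ^ n) V \<and> real (card V) \<le> C ^ n"
    if n: "n \<ge> L * (K + N\<^sub>1 + N\<^sub>2 + 1)" for n
  proof -
    define k where "k = n div L"
    have k: "k \<ge> K + N\<^sub>1 + N\<^sub>2 + 1"
      unfolding k_def using n L(2) by (simp add: less_eq_div_iff_mult_less_eq mult.commute)
    have nL: "k * L \<le> n" "n < k * L + L"
      unfolding k_def using L(2) dividend_less_div_times[of L n] by (auto simp: add.commute)
    have "n \<le> 2 * L * k"
    proof -
      have "L \<le> k * L" using k by simp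
      then have "n \<le> k * L + k * L" using nL by linarith
      then show ?thesis by (simp add: algebra_simps)
    qed
    then have "c ^ n \<le> a ^ k"
      unfolding a_def power_mult[symmetric] using c by (intro power_increasing) auto
    moreover have "2 \<le> a ^ k"
      using K power_increasing[of K k a] k a1 by linarith
    ultimately have "2 * c ^ n \<le> a ^ k * a ^ k"
      using c by (intro mult_mono) auto
    also have "\<dots> = (a ^ 2) ^ k" by (simp add: power2_eq_square power_mult_distrib)
    finally have ca: "2 * c ^ n \<le> (a ^ 2) ^ k" .
    have c1k: "2 * c ^ n \<le> c\<^sub>1 ^ k"
      using ca power_mono[OF a2(1), of k] by simp
    have rest: "k * (L - 1) \<le> n - k" using nL(1) by (simp add: algebra_simps)
    moreover have "k * 1 \<le> k * (L - 1)" using L(2) by (intro mult_left_mono) auto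
    ultimately have "k \<le> n - k" by linarith
    then have kn: "k \<ge> N\<^sub>1" "n - k \<ge> N\<^sub>2" "k \<le> n" using k by linarith+
    obtain V V' where V: "dense_host k I D (c\<^sub>1 ^ k) V" "real (card V) \<le> C\<^sub>1 ^ k"
      and V': "dense_host (n - k) J D' (c\<^sub>2 ^ (n - k)) V'" "real (card V') \<le> C\<^sub>2 ^ (n - k)"
      using V1[OF kn(1)] V2[OF kn(2)] by blast
    have "2 * c ^ n * real (card V) ^ card I \<le> c\<^sub>2 ^ k * (C\<^sub>1 ^ k) ^ card I"
      using ca power_mono[OF a2(2), of k] V(2) c c2 by (intro mult_mono power_mono) auto
    also have "\<dots> = (c\<^sub>2 * C\<^sub>1 ^ card I) ^ k"
      by (simp add: power_mult_distrib flip: power_mult) (simp add: mult.commute)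
    also have "\<dots> \<le> (c\<^sub>2 ^ (L - 1)) ^ k"
      using L(1) c1 c2 by (intro power_mono) auto
    also have "\<dots> = c\<^sub>2 ^ (k * (L - 1))" by (simp add: mult.commute flip: power_mult)
    also have "\<dots> \<le> c\<^sub>2 ^ (n - k)" using rest c2 by (intro power_increasing) auto
    finally have *: "2 * c ^ n * real (card V) ^ card I \<le> c\<^sub>2 ^ (n - k)" .
    let ?V = "(\<lambda>(x, y). append_point k (n - k) x y) ` (V \<times> V')"
    have "dense_host (k + (n - k)) (I \<times> J) ?D (c ^ n) ?V"
      by (rule dense_host_product[OF V(1) V'(1) I _ _ c1k *]) (use c1 c in auto)
    moreover have "real (card ?V) \<le> C ^ n"
    proof -
      have "finite V" "finite V'" using V V' unfolding dense_host_def by auto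
      then have "card ?V \<le> card V * card V'"
        by (metis card_cartesian_product card_image_le finite_cartesian_product)
      then have "real (card ?V) \<le> real (card V) * real (card V')"
        by (metis of_nat_le_iff of_nat_mult)
      also have "\<dots> \<le> C ^ k * C ^ (n - k)"
      proof (rule mult_mono)
        show "real (card V) \<le> C ^ k"
          using V(2) power_mono[of C\<^sub>1 C k] c1 unfolding C_def by simp
        show "real (card V') \<le> C ^ (n - k)"
          using V'(2) power_mono[of C\<^sub>2 C "n - k"] c2 unfolding C_def by simp
      qed (use c1 in \<open>auto simp: C_def\<close>)
      finally show ?thesis using kn(3) by (simp flip: power_add)
    qed
    ultimately show ?thesis using kn(3) by auto
  qed
  then show ?thesis
    unfolding exp_dense_def eventually_sequentially
    using c c1 by (intro exI[of _ c] exI[of _ C] conjI) (auto simp: C_def)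
qed

section \<open>Weighted cubes\<close>

text \<open>Subsets of \<open>E\<close> are the vertices of the box with edge lengths \<open>w\<close>, and their distance is the total
  weight of the symmetric difference. Each edge is one more two-point factor.\<close>

lemma exp_dense_weighted_cube:
  fixes w :: "'e \<Rightarrow> real"
  assumes "finite E" "\<And>e. e \<in> E \<Longrightarrow> w e > 0"
  shows "exp_dense (Pow E) (\<lambda>S T. sum w (sym_diff S T))"
  using assms
proof (induction E)
  case empty
  show ?case by (rule exp_dense_embed[OF exp_dense_singleton[of "{}"], of id]) auto
next
  case (insert e E)
  let ?D = "\<lambda>(S, b) (T, b'). sum w (sym_diff S T) + (if b = b' then 0 else w e)"
  have "exp_dense (Pow E \<times> (UNIV :: bool set)) ?D"
    using insert by (intro exp_dense_product exp_dense_two_points) auto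
  then show ?case
  proof (rule exp_dense_embed[where g = "\<lambda>S. (S - {e}, e \<in> S)"])
    fix S T assume ST: "S \<in> Pow (insert e E)" "T \<in> Pow (insert e E)"
    have fin: "finite (sym_diff S T)" using ST insert.hyps(1)
      by (meson PowD finite.insertI finite_Diff finite_UnI finite_subset)
    have eq: "sym_diff (S - {e}) (T - {e}) = sym_diff S T - {e}" by auto
    have "e \<in> sym_diff S T \<longleftrightarrow> (e \<in> S) \<noteq> (e \<in> T)" by auto
    then show "?D (S - {e}, e \<in> S) (T - {e}, e \<in> T) = sum w (sym_diff S T)"
      using fin by (simp add: eq sum_diff1 del: Un_iff Diff_iff)
  qed auto
qed

text \<open>The weight of a point is its distance to its predecessor in \<open>A\<close>, so that the sums telescope.
  The least point has no predecessor; it occurs in none of the sums and gets weight 1.\<close>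

lemma real_gaps:
  fixes A :: "real set"
  assumes "finite A"
  shows "\<exists>w. (\<forall>v\<in>A. w v > 0) \<and> (\<forall>a\<in>A. \<forall>b\<in>A. a \<le> b \<longrightarrow> sum w {v \<in> A. a < v \<and> v \<le> b} = b - a)"
  using assms
proof (induction A rule: finite_linorder_max_induct)
  case empty
  show ?case by simp
next
  case (insert b A)
  then obtain w where w: "\<And>v. v \<in> A \<Longrightarrow> w v > 0"
    "\<And>x y. x \<in> A \<Longrightarrow> y \<in> A \<Longrightarrow> x \<le> y \<Longrightarrow> sum w {v \<in> A. x < v \<and> v \<le> y} = y - x" by blast
  have bA: "b \<notin> A" using insert.hyps(2) by blast
  define gap where "gap = (if A = {} then 1 else b - Max A)"
  let ?w = "w(b := gap)"
  have pos: "gap > 0" using insert.hyps unfolding gap_def by auto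
  have "sum ?w {v \<in> insert b A. x < v \<and> v \<le> y} = y - x"
    if xy: "x \<in> insert b A" "y \<in> insert b A" "x \<le> y" for x y
  proof (cases "y = b")
    case False
    then have "x \<in> A" "y \<in> A" using xy insert.hyps(2) by (auto dest: bspec)
    then have "{v \<in> insert b A. x < v \<and> v \<le> y} = {v \<in> A. x < v \<and> v \<le> y}"
      using insert.hyps(2) by auto
    moreover have "sum ?w {v \<in> A. x < v \<and> v \<le> y} = sum w {v \<in> A. x < v \<and> v \<le> y}"
      using bA by (intro sum.cong) auto
    ultimately show ?thesis using w(2) \<open>x \<in> A\<close> \<open>y \<in> A\<close> xy(3) by simp
  next
    case yb: True
    show ?thesis
    proof (cases "x = b")
      case True
      then have "{v \<in> insert b A. x < v \<and> v \<le> y} = {}" using yb by auto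
      then show ?thesis using True yb by (simp only: sum.empty)
    next
      case False
      then have x: "x \<in> A" "x < b" using xy insert.hyps(2) by auto
      have M: "Max A \<in> A" "x \<le> Max A" using x insert.hyps(1) by (auto intro: Max_in)
      have "{v \<in> insert b A. x < v \<and> v \<le> y} = insert b {v \<in> A. x < v \<and> v \<le> Max A}"
        using yb x insert.hyps by (auto dest: bspec)
      also have "sum ?w \<dots> = gap + sum ?w {v \<in> A. x < v \<and> v \<le> Max A}"
        using bA insert.hyps(1) by simp
      also have "sum ?w {v \<in> A. x < v \<and> v \<le> Max A} = sum w {v \<in> A. x < v \<and> v \<le> Max A}"
        using bA by (intro sum.cong) auto
      also have "\<dots> = Max A - x" using w(2) x M by blast
      finally show ?thesis using x yb unfolding gap_def by auto
    qed
  qed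
  moreover have "\<forall>v\<in>insert b A. ?w v > 0" using w(1) pos by auto
  ultimately show ?case by blast
qed

text \<open>A point is encoded by the thresholds \<open>(i, v)\<close> that it reaches. Two points differ at the
  thresholds between their coordinates, whose weights add up to the \<open>\<ell>\<^sub>1\<close> distance.\<close>

lemma exp_dense_finite_l1_set:
  fixes M :: "(nat \<Rightarrow> real) set"
  assumes "finite M"
  shows "exp_dense M (l1_dist d)"
proof -
  define A where "A = (\<Union>i<d. (\<lambda>x. x i) ` M)"
  have A: "finite A" "\<And>x i. x \<in> M \<Longrightarrow> i < d \<Longrightarrow> x i \<in> A" using assms unfolding A_def by auto
  obtain w where w: "\<And>v. v \<in> A \<Longrightarrow> w v > 0"
    "\<And>a b. a \<in> A \<Longrightarrow> b \<in> A \<Longrightarrow> a \<le> b \<Longrightarrow> sum w {v \<in> A. a < v \<and> v \<le> b} = b - a"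
    using real_gaps[OF A(1)] by blast
  define E where "E = {..<d} \<times> A"
  define below where "below x = {(i, v) \<in> E. v \<le> x i}" for x :: "nat \<Rightarrow> real"
  have gap: "sum w {v \<in> A. (v \<le> a) \<noteq> (v \<le> b)} = \<bar>a - b\<bar>" if "a \<in> A" "b \<in> A" for a b
  proof (cases "a \<le> b")
    case True
    then have "{v \<in> A. (v \<le> a) \<noteq> (v \<le> b)} = {v \<in> A. a < v \<and> v \<le> b}" by auto
    then show ?thesis using w(2)[OF that True] True by simp
  next
    case False
    then have "{v \<in> A. (v \<le> a) \<noteq> (v \<le> b)} = {v \<in> A. b < v \<and> v \<le> a}" by auto
    then show ?thesis using w(2)[of b a] that False by simp
  qed
  have "exp_dense (Pow E) (\<lambda>S T. sum (w \<circ> snd) (sym_diff S T))"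
    using A(1) w(1) by (intro exp_dense_weighted_cube) (auto simp: E_def)
  then show ?thesis
  proof (rule exp_dense_embed[where g = below])
    fix x y assume xy: "x \<in> M" "y \<in> M"
    have "sym_diff (below x) (below y) = (SIGMA i:{..<d}. {v \<in> A. (v \<le> x i) \<noteq> (v \<le> y i)})"
      unfolding below_def E_def by auto
    also have "sum (w \<circ> snd) \<dots> = (\<Sum>i<d. sum w {v \<in> A. (v \<le> x i) \<noteq> (v \<le> y i)})"
      using A(1) by (subst sum.Sigma) (auto simp: case_prod_unfold)
    also have "\<dots> = l1_dist d x y"
      unfolding l1_dist_def l1_norm_def using gap A(2) xy by (intro sum.cong) auto
    finally show "sum (w \<circ> snd) (sym_diff (below x) (below y)) = l1_dist d x y" .
  qed (auto simp: below_def)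
qed

section \<open>Independence ratios and colourings\<close>

lemma realizes_l1_dist_imp_copy:
  assumes "M \<subseteq> real_space d" "W \<subseteq> real_space n" "realizes n M (l1_dist d) W"
  shows "\<exists>M'\<subseteq>W. l1_isometric_copy d M n M'"
proof -
  obtain f where "f ` M \<subseteq> W \<and> (\<forall>x\<in>M. \<forall>y\<in>M. l1_dist n (f x) (f y) = l1_dist d x y)"
    using assms(3) unfolding realizes_def ..
  then have f: "f ` M \<subseteq> W" "\<forall>x\<in>M. \<forall>y\<in>M. l1_dist n (f x) (f y) = l1_dist d x y"
    by (rule conjunct1, rule conjunct2)
  have "inj_on f M"
  proof (rule inj_onI)
    fix x y assume "x \<in> M" "y \<in> M" "f x = f y"
    then have "l1_dist d x y = 0" using f(2) by (metis l1_dist_self)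
    then show "x = y" using \<open>x \<in> M\<close> \<open>y \<in> M\<close> assms(1) by (intro l1_dist_eq_0D[of x d y]) auto
  qed
  then have "bij_betw f M (f ` M)" by (rule inj_on_imp_bij_betw)
  moreover have "f ` M \<subseteq> real_space n" using f(1) assms(2) by blast
  moreover have "\<forall>x\<in>M. \<forall>y\<in>M. l1_dist d x y = l1_dist n (f x) (f y)" using f(2) by simp
  ultimately have "l1_isometric_copy d M n (f ` M)"
    unfolding l1_isometric_copy_def using assms(1) by (intro conjI exI[of _ f])
  then show ?thesis using f(1) by (intro exI conjI)
qed

lemma copy_free_subset_small:
  assumes "M \<subseteq> real_space d" "dense_host n M (l1_dist d) s V"
    and "W \<subseteq> V" "\<not> (\<exists>M'\<subseteq>W. l1_isometric_copy d M n M')"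
  shows "s * real (card W) < real (card V)"
proof -
  have "W \<subseteq> real_space n" using assms(2,3) unfolding dense_host_def by blast
  then have "\<not> realizes n M (l1_dist d) W" using realizes_l1_dist_imp_copy assms(1,4) by blast
  then show ?thesis using assms(2,3) unfolding dense_host_def by (meson not_le)
qed

text \<open>Nonemptiness of \<open>M\<close> makes the empty set copy-free, so that the maximum in \<open>l1_alpha\<close> is attained
  by an actual copy-free set.\<close>

lemma dense_host_alpha_ratio:
  assumes M: "M \<subseteq> real_space d" "M \<noteq> {}" and V: "dense_host n M (l1_dist d) s V"
  shows "ereal s \<le> ereal (real (card V)) / ereal (real (l1_alpha n V d M))"
proof -
  let ?S = "{card W |W. W \<subseteq> V \<and> \<not> (\<exists>M'\<subseteq>W. l1_isometric_copy d M n M')}"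
  have fin: "finite V" and pos: "card V > 0" using V unfolding dense_host_def by (auto simp: card_gt_0_iff)
  have "?S \<subseteq> {..card V}" using fin by (auto intro: card_mono)
  then have "finite ?S" using finite_subset by blast
  moreover have "\<not> (\<exists>M'\<subseteq>{}. l1_isometric_copy d M n M')"
    using M(2) unfolding l1_isometric_copy_def by (auto simp: bij_betw_def)
  then have "card ({} :: (nat \<Rightarrow> real) set) \<in> ?S" by blast
  ultimately have "l1_alpha n V d M \<in> ?S"
    unfolding l1_alpha_def by (intro Max_in) auto
  then have less: "s * real (l1_alpha n V d M) < real (card V)"
    using copy_free_subset_small[OF M(1) V] by auto
  show ?thesis
  proof (cases "l1_alpha n V d M = 0")
    case True
    then show ?thesis using pos by simp
  next
    case False
    then show ?thesis using less by (simp add: field_simps)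
  qed
qed

lemma dense_host_chromatic_bound:
  assumes M: "M \<subseteq> real_space d" and V: "dense_host n M (l1_dist d) s V"
  shows "ereal s \<le> ereal_of_enat (l1_chromatic_number n d M)"
proof -
  have V': "finite V" "card V > 0" "V \<subseteq> real_space n"
    using V unfolding dense_host_def by (auto simp: card_gt_0_iff)
  have bound: "s \<le> real r" if c: "copy_free_coloring d M n r c" for r c
  proof -
    let ?W = "\<lambda>k. {x \<in> V. c x = k}"
    have "c ` V \<subseteq> {..<r}" using c V'(3) unfolding copy_free_coloring_def by auto
    then have "card V = (\<Sum>k<r. card (?W k))"
      using sum.group[OF V'(1) finite_lessThan, of c r "\<lambda>_. 1::nat"] by simp
    then have "s * real (card V) = (\<Sum>k<r. s * real (card (?W k)))"
      by (simp add: sum_distrib_left)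
    also have "\<dots> \<le> (\<Sum>k<r. real (card V))"
    proof (rule sum_mono)
      fix k
      have "\<not> (\<exists>M'\<subseteq>?W k. l1_isometric_copy d M n M')"
        using c unfolding copy_free_coloring_def by blast
      then show "s * real (card (?W k)) \<le> real (card V)"
        using copy_free_subset_small[OF M V, of "?W k"] by auto
    qed
    finally show ?thesis using V'(2) by simp
  qed
  show ?thesis
  proof (cases "l1_chromatic_number n d M")
    case (enat r)
    let ?R = "{enat r |r. \<exists>c. copy_free_coloring d M n r c}"
    have "?R \<noteq> {}"
    proof
      assume "?R = {}"
      then have "l1_chromatic_number n d M = Inf {}" unfolding l1_chromatic_number_def by (rule arg_cong)
      then show False using enat by (simp add: Inf_enat_def)
    qed
    then obtain z where "z \<in> ?R" by blast
    then have "(LEAST z. z \<in> ?R) \<in> ?R" by (rule LeastI)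
    then have "Inf ?R \<in> ?R" using \<open>?R \<noteq> {}\<close> unfolding Inf_enat_def by simp
    then show ?thesis using enat bound unfolding l1_chromatic_number_def by auto
  next
    case infinity
    then show ?thesis by simp
  qed
qed

theorem theorem9:
  fixes d :: nat and M :: "(nat \<Rightarrow> real) set"
  assumes "M \<subseteq> real_space d" and "finite M" and "M \<noteq> {}"
  shows "super_Ramsey d M \<and>
    (\<exists>\<epsilon>>0. eventually_ge_power \<epsilon> (\<lambda>n. ereal_of_enat (l1_chromatic_number n d M)))"
proof -
  obtain c C N where c: "c > 1" "C \<ge> 1"
    and host: "\<And>n. n \<ge> N \<Longrightarrow> \<exists>V. dense_host n M (l1_dist d) (c ^ n) V \<and> real (card V) \<le> C ^ n"
    using exp_dense_finite_l1_set[OF assms(2), of d]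
    unfolding exp_dense_def eventually_sequentially by blast
  then obtain V where V: "\<And>n. n \<ge> N \<Longrightarrow> dense_host n M (l1_dist d) (c ^ n) (V n)"
    "\<And>n. n \<ge> N \<Longrightarrow> real (card (V n)) \<le> C ^ n" by metis
  have power: "eventually_ge_power (c - 1) g" if "\<And>n. n \<ge> N \<Longrightarrow> ereal (c ^ n) \<le> g n" for g
    unfolding eventually_ge_power_def
    using that by (intro exI[of _ "\<lambda>_. 0"] conjI eventually_sequentiallyI[of N]) auto
  \<comment> \<open>The size bound concerns every dimension, the ratio only the large ones.\<close>
  define V' where "V' n = (if n \<ge> N then V n else {\<lambda>i\<in>{..<n}. 0})" for n
  have "\<forall>n. V' n \<subseteq> real_space n \<and> finite (V' n) \<and> V' n \<noteq> {} \<and> real (card (V' n)) \<le> C ^ n"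
    using V c(2) unfolding V'_def dense_host_def by auto
  moreover have "eventually_ge_power (c - 1)
      (\<lambda>n. ereal (real (card (V' n))) / ereal (real (l1_alpha n (V' n) d M)))"
  proof (rule power)
    fix n assume "n \<ge> N"
    then show "ereal (c ^ n) \<le> ereal (real (card (V' n))) / ereal (real (l1_alpha n (V' n) d M))"
      using dense_host_alpha_ratio[OF assms(1,3) V(1)] unfolding V'_def by simp
  qed
  ultimately have "super_Ramsey d M"
    unfolding super_Ramsey_def using c by (intro exI[of _ "c - 1"] exI[of _ C] exI[of _ V'] conjI) auto
  moreover have "eventually_ge_power (c - 1) (\<lambda>n. ereal_of_enat (l1_chromatic_number n d M))"
    using dense_host_chromatic_bound[OF assms(1) V(1)] by (intro power) auto
  then have "\<exists>\<epsilon>>0. eventually_ge_power \<epsilon> (\<lambda>n. ereal_of_enat (l1_chromatic_number n d M))"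
    using c(1) by (intro exI[of _ "c - 1"]) auto
  ultimately show ?thesis by blast
qed

end
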